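(* Let $G$ be a connected graph of girth at least $g$ and minimum degree at least $\delta$. (i) If $g=6$ and $\delta=5$, then $\alpha_b(G)\le \alpha(G)+\rho(G)$. (ii) If $\xi$ is a real number with $2\le \xi<4$, $g=4$, and $\delta\ge \frac{10}{\xi}$, then $\alpha_b(G)\le \xi\,\alpha(G)$.
   Context: All graphs are finite, simple and undirected. $\alpha(G)$ is the independence number of $G$. A packing in $G$ is a set $P$ of vertices with $\mathrm{dist}_G(x,y)\ge 3$ for all distinct $x,y\in P$; $\rho(G)$ is the maximum cardinality of a packing. For a connected graph $G$, an independent broadcast on $G$ is a function $f:V(G)\to\{0,1,2,\dots\}$ such that (B1) $f(x)\le \mathrm{ecc}_G(x)$ for every vertex $x$, where $\mathrm{ecc}_G(x)$ is the eccentricity of $x$ in $G$, and (B2) $\mathrm{dist}_G(x,y)>\max\{f(x),f(y)\}$ for every two distinct vertices $x,y$ with $f(x),f(y)>0$. The weight of $f$ is $\sum_{x\in V(G)}f(x)$, and the broadcast independence number $\alpha_b(G)$ is the maximum weight of an independent broadcast on $G$. *)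

theory Defs
  imports "Graph_Theory.Graph_Theory"
begin

text \<open>
  A finite simple undirected graph is a symmetric digraph without loops and parallel arcs, i.e.
  an instance of the locale \<^locale>\<open>graph\<close>: every edge is a pair of opposite arcs.
\<close>

definition gdist :: "('a, 'b) pre_digraph \<Rightarrow> 'a \<Rightarrow> 'a \<Rightarrow> ereal" where
  "gdist G u v = wf_digraph.\<mu> G (\<lambda>_. 1) u v"

definition ecc :: "('a, 'b) pre_digraph \<Rightarrow> 'a \<Rightarrow> ereal" where
  "ecc G u = (SUP v\<in>verts G. gdist G u v)"

definition min_degree :: "('a, 'b) pre_digraph \<Rightarrow> nat" where
  "min_degree G = Min (out_degree G ` verts G)"

text \<open>
  Traversing an edge back and forth is a directed cycle of length 2, so the length bound is what
  singles out the cycles of the undirected graph. The girth of a forest is \<open>\<infinity>\<close>.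
\<close>

definition girth :: "('a, 'b) pre_digraph \<Rightarrow> enat" where
  "girth G = (INF p\<in>{p. pre_digraph.cycle G p \<and> 3 \<le> length p}. enat (length p))"

definition independent_set :: "('a, 'b) pre_digraph \<Rightarrow> 'a set \<Rightarrow> bool" where
  "independent_set G S \<longleftrightarrow> S \<subseteq> verts G \<and> (\<forall>x\<in>S. \<forall>y\<in>S. \<not> x \<rightarrow>\<^bsub>G\<^esub> y)"

definition independence_number :: "('a, 'b) pre_digraph \<Rightarrow> nat" where
  "independence_number G = Max (card ` {S. independent_set G S})"

definition packing :: "('a, 'b) pre_digraph \<Rightarrow> 'a set \<Rightarrow> bool" where
  "packing G P \<longleftrightarrow> P \<subseteq> verts G \<and> (\<forall>x\<in>P. \<forall>y\<in>P. x \<noteq> y \<longrightarrow> gdist G x y \<ge> 3)"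

definition packing_number :: "('a, 'b) pre_digraph \<Rightarrow> nat" where
  "packing_number G = Max (card ` {P. packing G P})"

text \<open>Values of \<open>f\<close> outside \<^term>\<open>verts G\<close> are irrelevant.\<close>

definition independent_broadcast :: "('a, 'b) pre_digraph \<Rightarrow> ('a \<Rightarrow> nat) \<Rightarrow> bool" where
  "independent_broadcast G f \<longleftrightarrow>
     (\<forall>x\<in>verts G. ereal (f x) \<le> ecc G x) \<and>
     (\<forall>x\<in>verts G. \<forall>y\<in>verts G. x \<noteq> y \<and> f x > 0 \<and> f y > 0 \<longrightarrow>
        gdist G x y > ereal (max (f x) (f y)))"

definition broadcast_weight :: "('a, 'b) pre_digraph \<Rightarrow> ('a \<Rightarrow> nat) \<Rightarrow> nat" where
  "broadcast_weight G f = (\<Sum>x\<in>verts G. f x)"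

definition broadcast_independence_number :: "('a, 'b) pre_digraph \<Rightarrow> nat" where
  "broadcast_independence_number G = Max (broadcast_weight G ` {f. independent_broadcast G f})"

end

theory Submission
  imports Defs
begin

text \<open>
  Let \<open>f\<close> be an independent broadcast of maximum weight. Balls of radius \<open>\<lfloor>(f(x)-1)/2\<rfloor>\<close> around the
  vertices with \<open>f(x) > 0\<close> are pairwise at distance at least 2, so independent sets \<open>I(x)\<close> chosen
  inside them have an independent disjoint union. Since \<open>f(x)\<close> is at most the eccentricity of \<open>x\<close>,
  vertices at all distances up to the radius exist, and neighbourhoods (girth at least 4) or second
  neighbourhoods (girth at least 6) of suitably spaced ones yield \<open>f(x) \<le> \<xi> |I(x)|\<close>, respectively
  \<open>f(x) \<le> |I(x)|\<close> unless \<open>f(x) = 2\<close>. The vertices with \<open>f(x) = 2\<close> form a packing, which makes up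
  for the missing unit.
\<close>

locale connected_graph = graph G for G :: "('a, 'b) pre_digraph" (structure) +
  assumes connected: "connected G"
begin

section \<open>Distance as the length of a shortest walk\<close>

definition hop_dist :: "'a \<Rightarrow> 'a \<Rightarrow> nat" where
  "hop_dist u v = (LEAST n. \<exists>p. awalk u p v \<and> length p = n)"

lemma hop_dist_le: "awalk u p v \<Longrightarrow> hop_dist u v \<le> length p"
  unfolding hop_dist_def by (rule Least_le) blast

lemma shortest_awalk:
  assumes "u \<in> verts G" "v \<in> verts G"
  obtains p where "awalk u p v" "length p = hop_dist u v"
proof -
  have "strongly_connected G"
    using symmetric_connected_imp_strongly_connected connected sym_arcs by blast
  then have "u \<rightarrow>\<^sup>* v" using assms by (simp add: strongly_connected_def)
  then have "\<exists>n p. awalk u p v \<and> length p = n" by (simp add: reachable_awalk)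
  from LeastI_ex[OF this] show ?thesis using that unfolding hop_dist_def by blast
qed

lemma awalk_cost_unit: "awalk_cost (\<lambda>_. 1) p = real (length p)"
  by (induction p) auto

text \<open>The infimum over all walks is attained by a shortest one, which exists by connectedness.
  From here on distances are natural numbers and open to linear arithmetic.\<close>

lemma gdist_eq_hop_dist:
  assumes "u \<in> verts G" "v \<in> verts G"
  shows "gdist G u v = ereal (real (hop_dist u v))"
proof -
  obtain p where p: "awalk u p v" "length p = hop_dist u v"
    using shortest_awalk[OF assms] .
  show ?thesis unfolding gdist_def \<mu>_def awalk_cost_unit
  proof (rule antisym)
    show "(INF p\<in>{p. awalk u p v}. ereal (real (length p))) \<le> ereal (real (hop_dist u v))"
      using p by (auto intro!: INF_lower2[of p])
    show "ereal (real (hop_dist u v)) \<le> (INF p\<in>{p. awalk u p v}. ereal (real (length p)))"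
      by (rule INF_greatest) (auto intro: hop_dist_le)
  qed
qed

lemma hop_dist_self: "v \<in> verts G \<Longrightarrow> hop_dist v v = 0"
  using hop_dist_le[of v "[]" v] by (simp add: awalk_Nil_iff)

lemma hop_dist_dominates:
  assumes "u \<rightarrow> v" shows "hop_dist u v \<le> 1"
proof -
  from assms obtain e where "e \<in> arcs G" "tail G e = u" "head G e = v" by auto
  then have "awalk u [e] v" by (auto simp: awalk_simps)
  from hop_dist_le[OF this] show ?thesis by simp
qed

lemma hop_dist_triangle:
  assumes "u \<in> verts G" "v \<in> verts G" "w \<in> verts G"
  shows "hop_dist u w \<le> hop_dist u v + hop_dist v w"
proof -
  obtain p q where "awalk u p v" "length p = hop_dist u v" "awalk v q w" "length q = hop_dist v w"
    using shortest_awalk assms by metis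
  then show ?thesis using hop_dist_le[of u "p @ q" w] awalk_appendI by fastforce
qed

lemma dominates_sym: "u \<rightarrow> v \<Longrightarrow> v \<rightarrow> u"
  using sym_arcs by (simp add: symmetric_def sym_def)

text \<open>Reversal needs new arcs: each arc is replaced by an opposite one, supplied by the
  symmetry of \<open>G\<close>.\<close>

lemma awalk_reverse: "awalk u p v \<Longrightarrow> \<exists>q. awalk v q u \<and> length q = length p"
proof (induction p arbitrary: u)
  case Nil
  then show ?case by (auto simp: awalk_Nil_iff)
next
  case (Cons e p)
  then have e: "e \<in> arcs G" "u = tail G e" "awalk (head G e) p v" by (auto simp: awalk_Cons_iff)
  then obtain q where q: "awalk v q (head G e)" "length q = length p" using Cons.IH by blast
  have "head G e \<rightarrow> u" using e dominates_sym[of u "head G e"] by (auto simp: arcs_ends_conv)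
  then obtain e' where "e' \<in> arcs G" "tail G e' = head G e" "head G e' = u" by auto
  then have "awalk (head G e) [e'] u" by (auto simp: awalk_simps)
  with q show ?case by (intro exI[of _ "q @ [e']"]) (auto intro: awalk_appendI)
qed

lemma hop_dist_commute:
  assumes "u \<in> verts G" "v \<in> verts G"
  shows "hop_dist u v = hop_dist v u"
proof -
  have "hop_dist b a \<le> hop_dist a b" if "a \<in> verts G" "b \<in> verts G" for a b
    using shortest_awalk[OF that] awalk_reverse hop_dist_le by metis
  with assms show ?thesis by (simp add: antisym)
qed

text \<open>Cut a shortest walk to \<open>z\<close> after \<open>i\<close> arcs. The end of the
  first piece is at distance at most \<open>i\<close> from \<open>x\<close>, and a smaller distance
  would give a shortcut to \<open>z\<close>.\<close>

lemma vertex_at_hop_dist: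
  assumes "x \<in> verts G" "z \<in> verts G" "i \<le> hop_dist x z"
  shows "\<exists>w \<in> verts G. hop_dist x w = i"
proof -
  obtain p where p: "awalk x p z" "length p = hop_dist x z" using shortest_awalk assms by metis
  define q r w where "q = take i p" and "r = drop i p" and "w = awlast x q"
  have "awalk x (q @ r) z" using p by (simp add: q_def r_def)
  then have qr: "awalk x q w" "awalk w r z" by (simp_all add: w_def)
  then have w: "w \<in> verts G" by blast
  have "hop_dist x w \<le> i" using hop_dist_le[OF qr(1)] by (simp add: q_def)
  moreover have "hop_dist w z \<le> hop_dist x z - i"
    using hop_dist_le[OF qr(2)] p by (simp add: r_def)
  moreover have "hop_dist x z \<le> hop_dist x w + hop_dist w z"
    using hop_dist_triangle assms w by blast
  ultimately have "hop_dist x w = i" using assms(3) by linarith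
  with w show ?thesis by blast
qed

lemma verts_nonempty: "verts G \<noteq> {}"
  using connected by (auto simp: connected_def strongly_connected_def)

text \<open>The supremum runs over a finite nonempty set, so it is attained. This turns the
  eccentricity bound on a broadcast into the existence of a distant vertex.\<close>

lemma vertex_at_ecc:
  assumes "x \<in> verts G"
  obtains z where "z \<in> verts G" "ecc G x = ereal (real (hop_dist x z))"
proof -
  have "ecc G x \<in> gdist G x ` verts G"
    unfolding ecc_def using verts_nonempty finite_verts
    by (subst cSup_eq_Max) (auto intro: Max_in)
  with assms that show ?thesis by (auto simp: gdist_eq_hop_dist)
qed

section \<open>Independent sets in separated balls\<close>

lemma independent_setD: "independent_set G S \<Longrightarrow> u \<in> S \<Longrightarrow> u \<in> verts G"
  by (auto simp: independent_set_def)

lemma finite_independent_set: "independent_set G S \<Longrightarrow> finite S"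
  unfolding independent_set_def using finite_subset[OF _ finite_verts] by blast

lemma card_le_independence_number:
  assumes "independent_set G S"
  shows "card S \<le> independence_number G"
proof -
  have "finite {S. independent_set G S}"
    by (rule finite_subset[of _ "Pow (verts G)"]) (auto simp: independent_set_def)
  with assms show ?thesis unfolding independence_number_def by (auto intro: Max_ge)
qed

lemma card_le_packing_number:
  assumes "packing G P"
  shows "card P \<le> packing_number G"
proof -
  have "finite {P. packing G P}"
    by (rule finite_subset[of _ "Pow (verts G)"]) (auto simp: packing_def)
  with assms show ?thesis unfolding packing_number_def by (auto intro: Max_ge)
qed

text \<open>Adjacent vertices are at distance at most 1, so no arc joins different pieces. A vertex
  common to two pieces would be at distance 0 from itself, so the pieces are disjoint and their
  cardinalities add up.\<close>

lemma independent_UN_separated: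
  assumes "finite A" and ind: "\<And>i. i \<in> A \<Longrightarrow> independent_set G (I i)"
    and sep: "\<And>i j u v. i \<in> A \<Longrightarrow> j \<in> A \<Longrightarrow> i \<noteq> j \<Longrightarrow> u \<in> I i \<Longrightarrow> v \<in> I j \<Longrightarrow> 2 \<le> hop_dist u v"
  shows "independent_set G (\<Union>i\<in>A. I i)" and "card (\<Union>i\<in>A. I i) = (\<Sum>i\<in>A. card (I i))"
proof -
  have "\<not> u \<rightarrow> v" if "i \<in> A" "j \<in> A" "u \<in> I i" "v \<in> I j" for i j u v
    using that ind[of i] sep[of i j u v] hop_dist_dominates[of u v]
    by (cases "i = j") (auto simp: independent_set_def)
  moreover have "I i \<subseteq> verts G" if "i \<in> A" for i
    using ind[OF that] by (simp add: independent_set_def)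
  ultimately show "independent_set G (\<Union>i\<in>A. I i)"
    unfolding independent_set_def by blast
  have "I i \<inter> I j = {}" if "i \<in> A" "j \<in> A" "i \<noteq> j" for i j
  proof (rule ccontr)
    assume "I i \<inter> I j \<noteq> {}"
    then obtain u where "u \<in> I i" "u \<in> I j" by blast
    then show False using sep[OF that, of u u] hop_dist_self[of u] independent_setD ind that by fastforce
  qed
  then show "card (\<Union>i\<in>A. I i) = (\<Sum>i\<in>A. card (I i))"
    using assms(1) ind finite_independent_set by (intro card_UN_disjoint) auto
qed

definition independent_in_ball :: "'a \<Rightarrow> nat \<Rightarrow> 'a set \<Rightarrow> bool" where
  "independent_in_ball x r J \<longleftrightarrow> independent_set G J \<and> (\<forall>w\<in>J. hop_dist x w \<le> r)"

text \<open>Vertices at distances \<open>0\<close>, \<open>2t+2\<close>, \<open>2(2t+2)\<close>, and so on from \<open>x\<close> have \<open>t\<close>-balls lying in bands of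
  distance from \<open>x\<close> that are two apart, so independent sets in these balls can be combined.\<close>

lemma independent_in_ball_spread:
  assumes x: "x \<in> verts G" and z: "z \<in> verts G" "r \<le> hop_dist x z" and t: "t \<le> r"
    and local: "\<And>v. v \<in> verts G \<Longrightarrow> \<exists>J. independent_in_ball v t J \<and> m \<le> card J"
  shows "\<exists>J. independent_in_ball x r J \<and> m * ((r - t) div (2 * t + 2) + 1) \<le> card J"
proof -
  define c where "c = 2 * t + 2"
  define n where "n = (r - t) div c"
  \<comment> \<open>\<open>n\<close> is the largest index for which the \<open>t\<close>-ball around
    a vertex at distance \<open>c * n\<close> still fits into the \<open>r\<close>-ball around
    \<open>x\<close>.\<close>
  have cn: "c * j + t \<le> r" if "j \<le> n" for j
  proof -
    have "c * j \<le> c * n" using that by simp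
    also have "\<dots> \<le> r - t" by (simp add: n_def)
    finally show ?thesis using t by linarith
  qed
  have "\<forall>j\<in>{..n}. \<exists>w. w \<in> verts G \<and> hop_dist x w = c * j"
    using vertex_at_hop_dist[OF x z(1)] cn z(2) by (metis add_leD1 atMost_iff le_trans)
  then obtain p where p: "p j \<in> verts G" "hop_dist x (p j) = c * j" if "j \<le> n" for j
    by (metis atMost_iff)
  obtain J where J: "independent_in_ball v t (J v)" "m \<le> card (J v)" if "v \<in> verts G" for v
    using local by metis
  \<comment> \<open>The lower bound is stated additively because \<open>c * j - t\<close> would be
    truncated at \<open>j = 0\<close>.\<close>
  have band: "u \<in> verts G" "hop_dist x u \<le> c * j + t" "c * j \<le> hop_dist x u + t"
    if "j \<le> n" "u \<in> J (p j)" for j u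
  proof -
    note pj = p[OF that(1)]
    show u: "u \<in> verts G" using J(1)[OF pj(1)] that(2)
      by (auto simp: independent_in_ball_def intro: independent_setD)
    have "hop_dist (p j) u \<le> t" using J(1)[OF pj(1)] that(2) by (auto simp: independent_in_ball_def)
    then show "hop_dist x u \<le> c * j + t" "c * j \<le> hop_dist x u + t"
      using hop_dist_triangle[OF x pj(1) u] hop_dist_triangle[OF x u pj(1)]
        hop_dist_commute[OF u pj(1)] pj(2) by linarith+
  qed
  \<comment> \<open>The spacing \<open>c = 2 * t + 2\<close> leaves a gap of 2 between the top of
    one band and the bottom of the next.\<close>
  have far: "2 \<le> hop_dist u v" if "i < j" "j \<le> n" "u \<in> J (p i)" "v \<in> J (p j)" for i j u v
  proof -
    have "c * (i + 1) \<le> c * j" using that by (intro mult_le_mono) auto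
    then have "c * i + 2 * t + 2 \<le> c * j" by (simp add: c_def algebra_simps)
    then show ?thesis
      using band[of i u] band[of j v] that hop_dist_triangle[OF x, of u v] by linarith
  qed
  have sep: "2 \<le> hop_dist u v" if "i \<in> {..n}" "j \<in> {..n}" "i \<noteq> j" "u \<in> J (p i)" "v \<in> J (p j)" for i j u v
    using that far[of i j u v] far[of j i v u] hop_dist_commute[of u v] band(1)[of i u] band(1)[of j v]
    by (cases i j rule: linorder_cases) auto
  have ind: "independent_set G (J (p j))" if "j \<in> {..n}" for j
    using J(1)[OF p(1)] that by (simp add: independent_in_ball_def)
  note U = independent_UN_separated[of "{..n}" "\<lambda>j. J (p j)", OF _ ind sep]
  have "hop_dist x u \<le> r" if "j \<le> n" "u \<in> J (p j)" for j u
    using band(2)[OF that] cn[OF that(1)] by linarith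
  then have "independent_in_ball x r (\<Union>j\<in>{..n}. J (p j))"
    using U(1) by (auto simp: independent_in_ball_def)
  moreover have "m * (n + 1) \<le> card (\<Union>j\<in>{..n}. J (p j))"
  proof -
    have "m * (n + 1) = (\<Sum>j\<le>n. m)" by simp
    also have "\<dots> \<le> (\<Sum>j\<le>n. card (J (p j)))" using J(2)[OF p(1)] by (intro sum_mono) auto
    also have "\<dots> = card (\<Union>j\<in>{..n}. J (p j))" using U(2) by simp
    finally show ?thesis .
  qed
  ultimately show ?thesis unfolding n_def c_def by blast
qed

section \<open>Independent broadcasts\<close>

lemma independent_broadcast_hop_dist:
  assumes "independent_broadcast G f" "x \<in> verts G" "y \<in> verts G" "x \<noteq> y" "0 < f x" "0 < f y"
  shows "max (f x) (f y) < hop_dist x y"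
  using assms unfolding independent_broadcast_def by (auto simp: gdist_eq_hop_dist)

text \<open>With m the larger of \<open>f x\<close> and \<open>f y\<close>, the two radii add up to
  at most m - 1 while \<open>x\<close> and \<open>y\<close> are at distance at least m + 1. Hence
  points of the two balls are at distance at least 2, and the sets \<open>I x\<close> unite to one
  independent set.\<close>

lemma sum_card_le_independence_number:
  assumes f: "independent_broadcast G f"
    and I: "\<And>x. x \<in> verts G \<Longrightarrow> 0 < f x \<Longrightarrow> independent_in_ball x ((f x - 1) div 2) (I x)"
  shows "(\<Sum>x\<in>{x\<in>verts G. 0 < f x}. card (I x)) \<le> independence_number G"
proof -
  let ?X = "{x\<in>verts G. 0 < f x}"
  have fin: "finite ?X" by simp
  have ind: "independent_set G (I x)" if "x \<in> ?X" for x
    using I that by (auto simp: independent_in_ball_def)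
  have sep: "2 \<le> hop_dist u v" if "x \<in> ?X" "y \<in> ?X" "x \<noteq> y" "u \<in> I x" "v \<in> I y" for x y u v
  proof -
    have V: "x \<in> verts G" "y \<in> verts G" "u \<in> verts G" "v \<in> verts G"
      using that ind independent_setD by blast+
    have "hop_dist x u \<le> (f x - 1) div 2" "hop_dist y v \<le> (f y - 1) div 2"
      using I that by (auto simp: independent_in_ball_def)
    moreover have "hop_dist x y \<le> hop_dist x u + hop_dist u v + hop_dist y v"
      using hop_dist_triangle[of x u y] hop_dist_triangle[of u v y] hop_dist_commute[of y v] V
      by linarith
    moreover have "f x < hop_dist x y" "f y < hop_dist x y"
      using independent_broadcast_hop_dist[OF f, of x y] that by auto
    ultimately show ?thesis using that by auto
  qed
  have "(\<Sum>x\<in>?X. card (I x)) = card (\<Union>x\<in>?X. I x)"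
    using independent_UN_separated(2)[of ?X I, OF fin ind sep] by simp
  also have "\<dots> \<le> independence_number G"
    by (rule card_le_independence_number, rule independent_UN_separated(1)[of ?X I, OF fin ind sep])
  finally show ?thesis .
qed

lemma weight_positive_part:
  "broadcast_weight G f = (\<Sum>x\<in>{x\<in>verts G. 0 < f x}. f x)"
  unfolding broadcast_weight_def by (rule sum.mono_neutral_right) auto

text \<open>\<open>Max\<close> is meaningful because the set of weights is finite, being bounded by
  the sum of the eccentricities, and contains the weight of the zero broadcast. Finiteness is
  claimed for the weights rather than the broadcasts, whose values outside \<open>verts G\<close>
  are arbitrary.\<close>

lemma broadcast_independence_number_attained:
  obtains f where "independent_broadcast G f" "broadcast_independence_number G = broadcast_weight G f"
proof -
  have "broadcast_weight G f \<le> (\<Sum>x\<in>verts G. nat \<lfloor>real_of_ereal (ecc G x)\<rfloor>)"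
    if "independent_broadcast G f" for f
    unfolding broadcast_weight_def
  proof (rule sum_mono)
    fix x assume x: "x \<in> verts G"
    then obtain z where "ecc G x = ereal (real (hop_dist x z))" using vertex_at_ecc by metis
    moreover have "ereal (f x) \<le> ecc G x" using that x by (auto simp: independent_broadcast_def)
    ultimately show "f x \<le> nat \<lfloor>real_of_ereal (ecc G x)\<rfloor>" by simp
  qed
  then have "finite (broadcast_weight G ` {f. independent_broadcast G f})"
    by (intro finite_subset[OF _ finite_atMost]) auto
  moreover have "independent_broadcast G (\<lambda>_. 0)"
    unfolding independent_broadcast_def
  proof (intro conjI ballI)
    fix x assume "x \<in> verts G"
    then obtain z where "ecc G x = ereal (real (hop_dist x z))" using vertex_at_ecc by metis
    then show "ereal (real 0) \<le> ecc G x" by simp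
  qed simp
  ultimately have "broadcast_independence_number G \<in> broadcast_weight G ` {f. independent_broadcast G f}"
    unfolding broadcast_independence_number_def by (intro Max_in) auto
  then show ?thesis using that by auto
qed

text \<open>Since \<open>f x\<close> is at most the eccentricity of \<open>x\<close>, some vertex is
  at least as far from \<open>x\<close> as the radius, which is what spreading centres over the ball
  requires.\<close>

lemma broadcast_spread:
  assumes f: "independent_broadcast G f" and x: "x \<in> verts G" and t: "t \<le> (f x - 1) div 2"
    and local: "\<And>v. v \<in> verts G \<Longrightarrow> \<exists>J. independent_in_ball v t J \<and> m \<le> card J"
  shows "\<exists>J. independent_in_ball x ((f x - 1) div 2) J \<and>
    m * (((f x - 1) div 2 - t) div (2 * t + 2) + 1) \<le> card J"
proof -
  obtain z where z: "z \<in> verts G" "ecc G x = ereal (real (hop_dist x z))" using vertex_at_ecc x .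
  have "ereal (real (f x)) \<le> ecc G x" using f x by (auto simp: independent_broadcast_def)
  then have "(f x - 1) div 2 \<le> hop_dist x z" using z by simp
  from independent_in_ball_spread[OF x z(1) this t local] show ?thesis .
qed

section \<open>Neighbourhoods and short cycles\<close>

definition nbrs :: "'a \<Rightarrow> 'a set" where
  "nbrs v = {u. v \<rightarrow> u}"

lemma nbrs_subset_verts: "nbrs v \<subseteq> verts G"
  unfolding nbrs_def by (auto intro: wellformed)

lemma finite_nbrs: "finite (nbrs v)"
  using finite_subset[OF nbrs_subset_verts finite_verts] .

lemma min_degree_le_card_nbrs:
  assumes "v \<in> verts G"
  shows "min_degree G \<le> card (nbrs v)"
proof -
  have "inj_on (head G) (out_arcs G v)"
    by (rule inj_onI) (auto intro: no_multi_arcs simp: arc_to_ends_def)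
  moreover have "nbrs v = head G ` out_arcs G v" by (auto simp: nbrs_def arcs_ends_conv)
  ultimately have "card (nbrs v) = out_degree G v" by (simp add: card_image out_degree_def)
  then show ?thesis unfolding min_degree_def using assms by (simp add: Min_le)
qed

lemma girth_le_cycle: "cycle p \<Longrightarrow> 3 \<le> length p \<Longrightarrow> girth G \<le> enat (length p)"
  unfolding girth_def by (auto intro: INF_lower)

lemma arcE:
  assumes "u \<rightarrow> v" obtains e where "e \<in> arcs G" "tail G e = u" "head G e = v"
  using assms by auto

lemma irrefl_dominates: "\<not> v \<rightarrow> v"
  using no_loops by (auto simp: arcs_ends_conv)

text \<open>Looplessness already makes the three vertices distinct. Closed walks of length 4 or 5
  may retrace an edge, so the next two lemmas ask for distinct vertices.\<close>

lemma girth_le_3: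
  assumes "a \<rightarrow> b" "b \<rightarrow> c" "c \<rightarrow> a"
  shows "girth G \<le> 3"
proof -
  obtain e1 e2 e3 where e: "e1 \<in> arcs G" "tail G e1 = a" "head G e1 = b"
    "e2 \<in> arcs G" "tail G e2 = b" "head G e2 = c" "e3 \<in> arcs G" "tail G e3 = c" "head G e3 = a"
    using assms by (metis arcE)
  have "a \<noteq> b" "b \<noteq> c" "c \<noteq> a" using assms irrefl_dominates by blast+
  moreover have "a \<in> verts G" using e by auto
  ultimately have "cycle [e1, e2, e3]"
    using e unfolding cycle_def by (intro exI[of _ a]) (auto simp: awalk_def)
  from girth_le_cycle[OF this] show ?thesis by (simp add: numeral_eq_enat eval_nat_numeral)
qed

lemma girth_le_4:
  assumes "a \<rightarrow> b" "b \<rightarrow> c" "c \<rightarrow> d" "d \<rightarrow> a" "distinct [a, b, c, d]"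
  shows "girth G \<le> 4"
proof -
  obtain e1 e2 e3 e4 where e: "e1 \<in> arcs G" "tail G e1 = a" "head G e1 = b"
    "e2 \<in> arcs G" "tail G e2 = b" "head G e2 = c" "e3 \<in> arcs G" "tail G e3 = c" "head G e3 = d"
    "e4 \<in> arcs G" "tail G e4 = d" "head G e4 = a"
    using assms by (metis arcE)
  then have "cycle [e1, e2, e3, e4]"
    using assms(5) unfolding cycle_def by (intro exI[of _ a]) (auto simp: awalk_def)
  from girth_le_cycle[OF this] show ?thesis by (simp add: numeral_eq_enat eval_nat_numeral)
qed

lemma girth_le_5:
  assumes "a \<rightarrow> b" "b \<rightarrow> c" "c \<rightarrow> d" "d \<rightarrow> e" "e \<rightarrow> a" "distinct [a, b, c, d, e]"
  shows "girth G \<le> 5"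
proof -
  obtain e1 e2 e3 e4 e5 where e: "e1 \<in> arcs G" "tail G e1 = a" "head G e1 = b"
    "e2 \<in> arcs G" "tail G e2 = b" "head G e2 = c" "e3 \<in> arcs G" "tail G e3 = c" "head G e3 = d"
    "e4 \<in> arcs G" "tail G e4 = d" "head G e4 = e" "e5 \<in> arcs G" "tail G e5 = e" "head G e5 = a"
    using assms by (metis arcE)
  then have "cycle [e1, e2, e3, e4, e5]"
    using assms(6) unfolding cycle_def by (intro exI[of _ a]) (auto simp: awalk_def)
  from girth_le_cycle[OF this] show ?thesis by (simp add: numeral_eq_enat eval_nat_numeral)
qed

lemma independent_in_ball_singleton:
  "x \<in> verts G \<Longrightarrow> independent_in_ball x r {x}"
  using irrefl_dominates by (simp add: independent_in_ball_def independent_set_def hop_dist_self)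

text \<open>Two adjacent neighbours of \<open>v\<close> would form a triangle with it.\<close>

lemma independent_in_ball_nbrs:
  assumes "4 \<le> girth G"
  shows "independent_in_ball v 1 (nbrs v)"
proof -
  have "\<not> girth G \<le> 3" using assms by (auto dest: order_trans)
  then have "\<not> a \<rightarrow> b" if "v \<rightarrow> a" "v \<rightarrow> b" for a b
    using girth_le_3[of v a b] that dominates_sym by blast
  then show ?thesis
    using nbrs_subset_verts hop_dist_dominates
    by (auto simp: independent_in_ball_def independent_set_def nbrs_def)
qed

definition second_nbrs :: "'a \<Rightarrow> 'a set" where
  "second_nbrs v = (\<Union>u\<in>nbrs v. nbrs u - {v})"

text \<open>An arc between second neighbours \<open>w\<close> and \<open>w'\<close> closes the walk
  \<open>v\<close>, \<open>u\<close>, \<open>w\<close>, \<open>w'\<close>, \<open>u'\<close>. This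
  is a 5-cycle if its vertices are distinct, and every possible coincidence produces a
  triangle.\<close>

lemma independent_in_ball_second_nbrs:
  assumes "6 \<le> girth G" "v \<in> verts G"
  shows "independent_in_ball v 2 (second_nbrs v)"
proof -
  have g: "\<not> girth G \<le> 3" "\<not> girth G \<le> 5" using assms by (auto dest: order_trans)
  have ind: "\<not> w \<rightarrow> w'" if "v \<rightarrow> u" "u \<rightarrow> w" "w \<noteq> v" "v \<rightarrow> u'" "u' \<rightarrow> w'" "w' \<noteq> v" for u u' w w'
  proof
    assume ww: "w \<rightarrow> w'"
    note tri = girth_le_3[THEN notE[OF g(1)]]
    have "u \<noteq> u'" using tri[OF that(2) ww] that dominates_sym by blast
    \<comment> \<open>Either equality would make \<open>u\<close> and \<open>u'\<close> adjacent,
      giving a triangle with \<open>v\<close>.\<close>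
    moreover have "w \<noteq> u'" "w' \<noteq> u"
      using tri[of v u u'] tri[of v u' u] that dominates_sym by blast+
    ultimately have "distinct [v, u, w, w', u']"
      using that ww irrefl_dominates by auto
    then show False using girth_le_5[of v u w w' u'] g(2) that ww dominates_sym by blast
  qed
  have ball: "hop_dist v w \<le> 2" if "v \<rightarrow> u" "u \<rightarrow> w" for u w
    using hop_dist_dominates[OF that(1)] hop_dist_dominates[OF that(2)] hop_dist_triangle[of v u w]
      nbrs_subset_verts[of v] nbrs_subset_verts[of u] that assms(2) by (fastforce simp: nbrs_def)
  have mem: "\<exists>u. v \<rightarrow> u \<and> u \<rightarrow> w \<and> w \<noteq> v" if "w \<in> second_nbrs v" for w
    using that by (auto simp: second_nbrs_def nbrs_def)
  show ?thesis
    unfolding independent_in_ball_def independent_set_def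
  proof (intro conjI ballI)
    show "second_nbrs v \<subseteq> verts G" using nbrs_subset_verts by (auto simp: second_nbrs_def)
    show "\<not> w \<rightarrow> w'" if "w \<in> second_nbrs v" "w' \<in> second_nbrs v" for w w'
      using mem[OF that(1)] mem[OF that(2)] ind by blast
    show "hop_dist v w \<le> 2" if "w \<in> second_nbrs v" for w
      using mem[OF that] ball by blast
  qed
qed

text \<open>Without 4-cycles, different neighbours of \<open>v\<close> share no neighbour other than
  \<open>v\<close>. So there are at least \<open>d + 1\<close> disjoint sets, each keeping at least
  \<open>d\<close> vertices after the removal of \<open>v\<close>.\<close>

lemma card_second_nbrs:
  assumes "6 \<le> girth G" "d + 1 \<le> min_degree G" "v \<in> verts G"
  shows "(d + 1) * d \<le> card (second_nbrs v)"
proof -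
  have g: "\<not> girth G \<le> 4" using assms(1) by (auto dest: order_trans)
  have "(nbrs u - {v}) \<inter> (nbrs u' - {v}) = {}" if "u \<in> nbrs v" "u' \<in> nbrs v" "u \<noteq> u'" for u u'
  proof (rule ccontr)
    assume "\<not> ?thesis"
    then obtain w where w: "u \<rightarrow> w" "u' \<rightarrow> w" "w \<noteq> v" by (auto simp: nbrs_def)
    then have "distinct [v, u, w, u']"
      using that irrefl_dominates by (auto simp: nbrs_def)
    then show False using girth_le_4[of v u w u'] g that w dominates_sym by (auto simp: nbrs_def)
  qed
  then have "card (second_nbrs v) = (\<Sum>u\<in>nbrs v. card (nbrs u - {v}))"
    unfolding second_nbrs_def using finite_nbrs by (intro card_UN_disjoint) auto
  also have "\<dots> \<ge> (\<Sum>u\<in>nbrs v. d)"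
  proof (rule sum_mono)
    fix u assume "u \<in> nbrs v"
    then have "d + 1 \<le> card (nbrs u)"
      using min_degree_le_card_nbrs[of u] nbrs_subset_verts assms(2) by fastforce
    then show "d \<le> card (nbrs u - {v})"
      using finite_nbrs[of u] by (cases "v \<in> nbrs u") auto
  qed
  finally have "(\<Sum>u\<in>nbrs v. d) \<le> card (second_nbrs v)" .
  moreover have "(d + 1) * d \<le> (\<Sum>u\<in>nbrs v. d)"
    using min_degree_le_card_nbrs[OF assms(3)] assms(2) by (simp add: mult_le_mono1 del: mult_Suc)
  ultimately show ?thesis by (rule order_trans[rotated])
qed

section \<open>The two upper bounds\<close>

lemma broadcast_le_independence_plus_packing:
  assumes girth: "6 \<le> girth G" and deg: "5 \<le> min_degree G"
  shows "broadcast_independence_number G \<le> independence_number G + packing_number G"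
proof -
  obtain f where f: "independent_broadcast G f"
    and w: "broadcast_independence_number G = broadcast_weight G f"
    using broadcast_independence_number_attained .
  have girth4: "4 \<le> girth G" using girth by (auto intro: order_trans[rotated])
  have one: "\<exists>J. independent_in_ball v 1 J \<and> 5 \<le> card J" if "v \<in> verts G" for v
    using independent_in_ball_nbrs[OF girth4] min_degree_le_card_nbrs[OF that] deg by (meson order_trans)
  have two: "\<exists>J. independent_in_ball v 2 J \<and> 20 \<le> card J" if "v \<in> verts G" for v
    using independent_in_ball_second_nbrs[OF girth that] card_second_nbrs[OF girth, of 4 v] deg that
    by auto
  \<comment> \<open>A singleton suffices for \<open>f x\<close> at most 1 and falls short by one at
    \<open>f x = 2\<close>. Values 3 and 4 have radius 1 and are covered by five neighbours; from 5
    on the radius admits second neighbourhoods.\<close>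
  have "\<exists>J. independent_in_ball x ((f x - 1) div 2) J \<and> f x \<le> card J + (if f x = 2 then 1 else 0)"
    if x: "x \<in> verts G" for x
  proof -
    consider "f x \<le> 2" | "f x \<in> {3, 4}" | "5 \<le> f x" by fastforce
    then show ?thesis
    proof cases
      case 1
      then show ?thesis using independent_in_ball_singleton[OF x] by (intro exI[of _ "{x}"]) auto
    next
      case 2
      then have "(f x - 1) div 2 = 1" "f x \<le> 5" by auto
      then show ?thesis using one[OF x] by (auto dest: order_trans)
    next
      case 3
      \<comment> \<open>\<open>n\<close> counts the centres for \<open>t = 2\<close>, spaced 6
        apart, each contributing 5 * 4 = 20 vertices.\<close>
      define n where "n = ((f x - 1) div 2 - 2) div (2 * 2 + 2) + 1"
      have "2 \<le> (f x - 1) div 2" using 3 by presburger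
      from broadcast_spread[OF f x this two] obtain J
        where J: "independent_in_ball x ((f x - 1) div 2) J" "20 * n \<le> card J"
        unfolding n_def by blast
      \<comment> \<open>The estimates combine to \<open>f x\<close> \<le> 2(6n + 1) + 2 = 12n + 4
        \<le> 16n, as n \<ge> 1.\<close>
      have "f x \<le> 2 * ((f x - 1) div 2) + 2" by presburger
      moreover have "a \<le> 6 * ((a - 2) div 6) + 7" for a :: nat by presburger
      from this[of "(f x - 1) div 2"] have "(f x - 1) div 2 \<le> 6 * n + 1" by (simp add: n_def)
      moreover have "1 \<le> n" by (simp add: n_def)
      ultimately have "f x \<le> 20 * n" by linarith
      with J show ?thesis by (intro exI[of _ J]) simp
    qed
  qed
  then obtain I where I: "independent_in_ball x ((f x - 1) div 2) (I x)"
      "f x \<le> card (I x) + (if f x = 2 then 1 else 0)" if "x \<in> verts G" for x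
    by metis
  let ?X = "{x\<in>verts G. 0 < f x}" and ?P = "{x\<in>verts G. f x = 2}"
  \<comment> \<open>Two vertices of value 2 are at distance greater than 2, so the missing units are
    counted by a packing.\<close>
  have "packing G ?P"
    unfolding packing_def
  proof (intro conjI ballI impI)
    fix x y assume "x \<in> ?P" "y \<in> ?P" "x \<noteq> y"
    then show "3 \<le> gdist G x y"
      using independent_broadcast_hop_dist[OF f, of x y] by (auto simp: gdist_eq_hop_dist)
  qed auto
  then have P: "card ?P \<le> packing_number G" by (rule card_le_packing_number)
  have "broadcast_weight G f \<le> (\<Sum>x\<in>?X. card (I x) + (if f x = 2 then 1 else 0))"
    unfolding weight_positive_part using I(2) by (intro sum_mono) auto
  also have "\<dots> = (\<Sum>x\<in>?X. card (I x)) + (\<Sum>x\<in>?X. if f x = 2 then 1 else 0)"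
    by (simp add: sum.distrib)
  also have "(\<Sum>x\<in>?X. if f x = 2 then 1 else 0) = card ?P"
    by (simp add: sum.If_cases) (rule arg_cong[where f = card], auto)
  finally show ?thesis
    using w P sum_card_le_independence_number[OF f I(1)] by simp
qed

lemma broadcast_le_mult_independence:
  fixes \<xi> :: real
  assumes girth: "4 \<le> girth G" and \<xi>: "2 \<le> \<xi>" and deg: "10 \<le> \<xi> * min_degree G"
  shows "broadcast_independence_number G \<le> \<xi> * independence_number G"
proof -
  obtain f where f: "independent_broadcast G f"
    and w: "broadcast_independence_number G = broadcast_weight G f"
    using broadcast_independence_number_attained .
  have one: "\<exists>J. independent_in_ball v 1 J \<and> min_degree G \<le> card J" if "v \<in> verts G" for v
    using independent_in_ball_nbrs[OF girth] min_degree_le_card_nbrs[OF that] by blast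
  \<comment> \<open>For values up to 2 a singleton suffices since 2 \<le> \<xi>. For larger values
    the radius is at least 1 and whole neighbourhoods fit.\<close>
  have "\<exists>J. independent_in_ball x ((f x - 1) div 2) J \<and> f x \<le> \<xi> * card J"
    if x: "x \<in> verts G" for x
  proof (cases "f x \<le> 2")
    case True
    then show ?thesis using independent_in_ball_singleton[OF x] \<xi> by (intro exI[of _ "{x}"]) auto
  next
    case False
    define n where "n = ((f x - 1) div 2 - 1) div (2 * 1 + 2) + 1"
    have "1 \<le> (f x - 1) div 2" using False by presburger
    from broadcast_spread[OF f x this one] obtain J
      where J: "independent_in_ball x ((f x - 1) div 2) J" "min_degree G * n \<le> card J"
      unfolding n_def by blast
    \<comment> \<open>For \<open>t = 1\<close> the centres are 4 apart, so the radius is at most 4n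
      and \<open>f x\<close> \<le> 8n + 2 \<le> 10n. This is the source of the 10 in the degree
      condition.\<close>
    have "f x \<le> 10 * n"
    proof -
      have "f x \<le> 2 * ((f x - 1) div 2) + 2" by presburger
      moreover have "a \<le> 4 * ((a - 1) div 4) + 4" for a :: nat by presburger
      from this[of "(f x - 1) div 2"]
      have "(f x - 1) div 2 \<le> 4 * n" unfolding n_def by simp
      moreover have "1 \<le> n" by (simp add: n_def)
      ultimately show ?thesis by linarith
    qed
    then have "real (f x) \<le> 10 * real n" by linarith
    also have "\<dots> \<le> \<xi> * min_degree G * n" using deg by (intro mult_right_mono) auto
    also have "\<dots> = \<xi> * real (min_degree G * n)" by simp
    also have "\<dots> \<le> \<xi> * card J" using J(2) \<xi> by (intro mult_left_mono) (auto simp del: of_nat_mult)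
    finally show ?thesis using J(1) by blast
  qed
  then obtain I where I: "independent_in_ball x ((f x - 1) div 2) (I x)"
      "f x \<le> \<xi> * card (I x)" if "x \<in> verts G" for x
    by metis
  let ?X = "{x\<in>verts G. 0 < f x}"
  have "real (broadcast_weight G f) \<le> (\<Sum>x\<in>?X. \<xi> * card (I x))"
    unfolding weight_positive_part of_nat_sum using I(2) by (intro sum_mono) auto
  also have "\<dots> = \<xi> * real (\<Sum>x\<in>?X. card (I x))"
    by (simp add: sum_distrib_left)
  also have "\<dots> \<le> \<xi> * independence_number G"
    using sum_card_le_independence_number[OF f I(1)] \<xi> by (intro mult_left_mono) (auto simp del: of_nat_sum)
  finally show ?thesis using w by simp
qed

end

theorem theorem3:
  fixes G :: "('a, 'b) pre_digraph" and g :: nat and \<delta> :: real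
  assumes "graph G" and "connected G"
    and "girth G \<ge> enat g" and "real (min_degree G) \<ge> \<delta>"
  shows "(g = 6 \<and> \<delta> = 5 \<longrightarrow>
            broadcast_independence_number G \<le> independence_number G + packing_number G) \<and>
         (\<forall>\<xi>::real. 2 \<le> \<xi> \<and> \<xi> < 4 \<and> g = 4 \<and> \<delta> \<ge> 10 / \<xi> \<longrightarrow>
            real (broadcast_independence_number G) \<le> \<xi> * real (independence_number G))"
proof -
  interpret connected_graph G
    using assms(1,2) by (simp add: connected_graph_def connected_graph_axioms_def)
  show ?thesis
  proof (intro conjI allI impI)
    assume "g = 6 \<and> \<delta> = 5"
    then show "broadcast_independence_number G \<le> independence_number G + packing_number G"
      using assms(3,4) by (intro broadcast_le_independence_plus_packing) (auto simp: numeral_eq_enat)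
  next
    fix \<xi> :: real
    assume *: "2 \<le> \<xi> \<and> \<xi> < 4 \<and> g = 4 \<and> \<delta> \<ge> 10 / \<xi>"
    then have "10 / \<xi> \<le> min_degree G" using assms(4) by linarith
    then have "10 \<le> \<xi> * min_degree G" using * by (simp add: field_simps)
    then show "real (broadcast_independence_number G) \<le> \<xi> * real (independence_number G)"
      using * assms(3) by (intro broadcast_le_mult_independence) (auto simp: numeral_eq_enat)
  qed
qed

end
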